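(* Let the risk frontier $\mathcal U$ have the recursive structure described in the context, and suppose the GCR-MDP $\min_{\pi\in\Pi}\varrho_{\mathcal U}(R^\pi_{0:T})$ has an information state generator $\mathcal I=\{(\mathbb Y_t,\sigma_t)\}_{t\in[T+1]}$. The value functions $\{\bar V_t\}_{t=0}^{T+1}$ on the information state satisfy the decomposition $$\bar V_t(y_t)=\min_{(X_t,z_t,\varphi_t)}\{\varphi_t:(X_t,z_t,\varphi_t)\in\bar{\mathcal Q}_t(y_t,\bar V_{t+1})\},\quad\forall y_t\in\mathbb Y_t,\ \forall t\in[T].$$ Furthermore, $\bar V_0(s_0)=\min_{\bar\pi\in\bar\Pi}\varrho_{\bar{\mathcal U}}(R_{0:T}^{\bar\pi})$.
   Context: Notation: $[n]=\{0,\dots,n\}$, $[n_1,n_2]=\{n_1,\dots,n_2\}$. Fix a horizon $0\le T<\infty$. MDP: the state space $\mathbb S$, action space $\mathbb A$ and data space $\Xi$ are finite, $s_0\in\mathbb S$ is fixed, $s_{t+1}=f_t(s_t,a_t,\xi_t)$ with $f_t:\mathbb S\times\mathbb A\times\Xi\to\mathbb S$ for $t\in[T-1]$; $\{\xi_t\}$ are independent with $\xi_t\sim P_t\in\mathcal P(\Xi)$. Payoffs are $r_t:\mathbb S\times\mathbb A\times\Xi\to\mathbb R$, $|r_t|\le R_{\max}<\infty$; $R_t(s,a)$ is the random payoff with $[R_t(s,a)](\xi_t)=r_t(s,a,\xi_t)$. Histories are $h_t=(s_0,a_0,\xi_0,\dots,a_{t-1},\xi_{t-1})$, $t\in[T+1]$;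 $\mathbb H_t$ is the set of them; $h_t$ implicitly determines past payoffs, disbursements and premiums (perfect recall). $\mathcal L_t$ is the space of bounded random variables determined by $h_t$; $\mathcal L_{t:T}=\prod_{k=t}^T\mathcal L_k$, $\mathcal L_{t+1:T+1}=\prod_{k=t+1}^{T+1}\mathcal L_k$. Payoffs satisfy $X_k\in\mathcal L_{k+1}$, disbursements and premiums $Z_k,\Phi_k\in\mathcal L_k$; $\varphi_0$ is the constant $\Phi_0$. Inequalities are componentwise and almost sure. $[\,\cdot\mid h_t]$, $[\,\cdot\mid y_t]$ denote conditioning. Policies: $\Pi$ is the set of $\pi=(\pi_t)_{t\in[T]}$, $\pi_t=(\pi_t^a,\pi_t^z):\mathbb H_t\to\mathbb A\times\mathbb R$; $R_t^\pi(h_t,\xi_t)=r_t(s_t,\pi_t^a(h_t),\xi_t)$, $Z_t^\pi(h_t)=\pi_t^z(h_t)$. Risk frontier: a set $\mathcal U\subset\mathcal L_{1:T+1}\times\mathcal L_{0:T}\times\mathcal L_{0:T}$ is a risk frontier if: (i) membership of $(X_{0:T},Z_{0:T},\Phi_{0:T})$ implies that of $(X'_{0:T},Z_{0:T},\Phi_{0:T})$ for all $X'_{0:T}\ge X_{0:T}$; (ii) membership of $(X_{0:T},Z_{0:T},\Phi_{0:T})$ implies that of $(X_{0:T},Z_{0:T},\Phi_{0:T}+\Phi'_{0:T})$ for all $\Phi'_{0:T}\ge0$ with $\Phi'_t(h_t)\ge\mathbb E[\Phi'_{t+1}\mid h_t]$ for all $h_t$, $t\in[T-1]$; (iii) membership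 of $(X_{0:T},Z_{0:T},\Phi_{0:T})$ and $Z'_{0:T}\ge Z_{0:T}$ imply membership of $(X_{0:T},Z'_{0:T},\Phi'_{0:T})$ for some $\Phi'_{0:T}\ge\Phi_{0:T}$; (iv) $\mathcal U$ is closed. The GCR-MDP is $\min_{\pi\in\Pi}\varrho_{\mathcal U}(R_{0:T}^\pi)\equiv\min_{\pi\in\Pi,\Phi_{0:T}}\{\varphi_0:(R_{0:T}^\pi,Z_{0:T}^\pi,\Phi_{0:T})\in\mathcal U\}$. Recursive structure: a terminal input $\Phi_{T+1}\in\mathcal L_{T+1}$ is fixed and there are correspondences $\mathcal U_t:\mathbb H_t\times\mathcal L_{t+1}\rightrightarrows\mathcal L_{t+1}\times\mathbb R\times\mathbb R$, $t\in[T]$, such that (a) $\mathcal U=\{(X_{0:T},Z_{0:T},\Phi_{0:T}):[(X_t,Z_t,\Phi_t)\mid h_t]\in\mathcal U_t(h_t,\Phi_{t+1}),\ \forall h_t\in\mathbb H_t,\ \forall t\in[T]\}$; (b) $(X_t,z_t,\varphi_t)\in\mathcal U_t(h_t,\Phi_{t+1})$ and $X_t\le X'_t$ imply $(X'_t,z_t,\varphi_t)\in\mathcal U_t(h_t,\Phi_{t+1})$; (c) $\Phi_{t+1}\le\Phi'_{t+1}$ implies $\mathcal U_t(h_t,\Phi'_{t+1})\subset\mathcal U_t(h_t,\Phi_{t+1})$ for all $h_t$. Information state: $\mathbb Y_t$ ($t\in[T+1]$) are Banach spaces, $\sigma_t:\mathbb H_t\to\mathbb Y_t$ are history compression functions,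 $s_t$ is a component of $y_t=\sigma_t(h_t)$, $Y_t=\sigma_t(h_t)$ with corresponding $\sigma$-field $\mathcal G_t$, and $\bar{\mathcal L}_t\subset\mathcal L_t$ consists of the random variables that are functions of $\sigma_t(h_t)$. $\mathcal I$ is an information state generator for the GCR-MDP if: (1) $\Pr(Y_{t+1}\in B\mid h_t,a_t,z_t)=\Pr(Y_{t+1}\in B\mid\sigma_t(h_t),a_t,z_t)$ for all $B\in\mathcal G_{t+1}$, $a_t\in\mathbb A$, $z_t\in\mathbb R$, $h_t\in\mathbb H_t$, $t\in[T]$; (2) $\bar\Phi_{T+1}=\Phi_{T+1}\in\bar{\mathcal L}_{T+1}$; (3) for $t\in[T]$, $\mathcal U_t(h_t,\bar\Phi_{t+1})=\mathcal U_t(h'_t,\bar\Phi_{t+1})$ for all $\bar\Phi_{t+1}\in\bar{\mathcal L}_{t+1}$ and all $h_t,h'_t$ with $\sigma_t(h_t)=\sigma_t(h'_t)$. The information state evolves by $y_{t+1}=g_t(y_t,a_t,z_t,\xi_t)$ with $g_t:\mathbb Y_t\times\mathbb A\times\mathbb R\times\Xi\to\mathbb Y_{t+1}$, $t\in[T]$. Elements $y_t\in\mathbb Y_t$ are understood to be values attained by $\sigma_t$. Conditioning convention: conditionally on $h_t$ (or $y_t$), the period-$t$ action $a$ and disbursement $z_t$, elements of $\mathcal L_{t+1}$ are regarded as random variables of $\xi_t$, namely $\xi_t\mapsto X_t(y_t,a,\xi_t)$ and $\xi_t\mapsto\bar\Phi_{t+1}(g_t(y_t,a,z_t,\xi_t))$,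 and membership in $\mathcal U_t$, $\bar{\mathcal U}_t$ is understood for these; $a$ is the policy's action, or the action $a$ in $\bar{\mathcal D}_t$ below. Compressed risk frontiers: $\bar{\mathcal U}_t(y_t,\bar\Phi_{t+1})=\mathcal U_t(h_t,\bar\Phi_{t+1})$ for any $h_t$ with $\sigma_t(h_t)=y_t$. $\bar{\mathcal U}$ is the subset of triples in $\mathcal U$ that are Markov with respect to the information state: $\bar{\mathcal U}=\{(X_{0:T},\bar Z_{0:T},\bar\Phi_{0:T}):[(X_t,\bar Z_t,\bar\Phi_t)\mid y_t]\in\bar{\mathcal U}_t(y_t,\bar\Phi_{t+1}),\ \forall y_t\in\mathbb Y_t,\ \forall t\in[T]\}$ with $\bar Z_t,\bar\Phi_t\in\bar{\mathcal L}_t$. $\bar\Pi\subset\Pi$ is the class of policies $\bar\pi_t:\mathbb Y_t\to\mathbb A\times\mathbb R$ depending only on the information state. The GCR-MDP on the information state is $\min_{\bar\pi\in\bar\Pi}\varrho_{\bar{\mathcal U}}(R_{0:T}^{\bar\pi})\equiv\min_{\bar\pi\in\bar\Pi,\bar\Phi_{0:T}}\{\varphi_0:(R_{0:T}^{\bar\pi},Z_{0:T}^{\bar\pi},\bar\Phi_{0:T})\in\bar{\mathcal U}\}$. Value functions: $\bar V_{T+1}=\bar\Phi_{T+1}$ is the given terminal input; for $t\in[T]$, $$\bar V_t^{\bar\pi_{t:T}}(y_t)=\min_{\bar\Phi_{t:T}}\{\bar\Phi_t(y_t):[(R_k^{\bar\pi},Z_k^{\bar\pi},\bar\Phi_k)\mid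 y_k]\in\bar{\mathcal U}_k(y_k,\bar\Phi_{k+1}),\ \forall y_k\in\mathbb Y_k,\ \forall k\in[t,T]\}$$ (infeasible problems have value $+\infty$) and $\bar V_t(y_t)=\min_{\bar\pi_{t:T}}\bar V_t^{\bar\pi_{t:T}}(y_t)$; the latter minima are understood to exist so that $\bar V_t$ is a bounded real function. $\bar V_0(s_0)$ means $\bar V_0(\sigma_0(s_0))$. Dominance constraints: $\bar{\mathcal D}_t(y_t,\bar V_{t+1})$ is the set of $(X_t,z_t,\bar\Phi_{t+1})\in\bar{\mathcal L}_{t+1}\times\mathbb R\times\bar{\mathcal L}_{t+1}$ for which there is $a\in\mathbb A$ with $X_t(y_t,a,\xi_t)\le r_t(s_t,a,\xi_t)$ and $\bar V_{t+1}(g_t(y_t,a,z_t,\xi_t))\le\bar\Phi_{t+1}(g_t(y_t,a,z_t,\xi_t))$ for all $\xi_t\in\Xi$. $\bar{\mathcal Q}_t(y_t,\bar V_{t+1})$ is the set of $(X_t,z_t,\varphi_t)$ such that, for some $\bar\Phi_{t+1}\in\bar{\mathcal L}_{t+1}$, $(X_t,z_t,\varphi_t)\in\bar{\mathcal U}_t(y_t,\bar\Phi_{t+1})$ and $(X_t,z_t,\bar\Phi_{t+1})\in\bar{\mathcal D}_t(y_t,\bar V_{t+1})$. *)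

theory Defs
  imports "HOL-Probability.Probability"
begin

text \<open>
  The state, action and data spaces are the finite types \<open>'s\<close>, \<open>'a\<close>, \<open>'x\<close>.
\<close>

record ('s, 'a, 'x) mdp =
  horizon :: nat
  init :: 's
  dyn :: "nat \<Rightarrow> 's \<Rightarrow> 'a \<Rightarrow> 'x \<Rightarrow> 's"
  law :: "nat \<Rightarrow> 'x pmf"
  payoff :: "nat \<Rightarrow> 's \<Rightarrow> 'a \<Rightarrow> 'x \<Rightarrow> real"

text \<open>
  A history of period \<open>t\<close> is the list of its pairs (action, datum); the initial state is a
  constant of the model and is left out. The set of these histories is finite, so that every real
  function on it is a bounded random variable. An adapted process \<open>Z\<close> is evaluated as
  \<open>Z t h\<close> with \<open>h \<in> hists t\<close>; a payoff process \<open>X\<close> as \<open>X t h\<close> with \<open>h \<in> hists (Suc t)\<close>.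
  Values at lists of any other length are junk and never matter.
\<close>

type_synonym ('a, 'x) hist = "('a \<times> 'x) list"
type_synonym ('a, 'x) process = "nat \<Rightarrow> ('a, 'x) hist \<Rightarrow> real"
type_synonym ('a, 'x) triple = "('a, 'x) process \<times> ('a, 'x) process \<times> ('a, 'x) process"

definition hists :: "nat \<Rightarrow> ('a, 'x) hist set" where
  "hists t = {h. length h = t}"

text \<open>
  Perfect recall: once a disbursement process \<open>Z\<close> is given, a history also determines the past
  disbursements. Compression functions and the risk correspondences may depend on them, hence take
  the history together with the disbursements made along it. Every list of triples arises
  as \<open>recall Z h\<close> for some \<open>Z\<close> and \<open>h\<close>.
\<close>

type_synonym ('a, 'x) recalled = "('a \<times> real \<times> 'x) list"

definition recalleds :: "nat \<Rightarrow> ('a, 'x) recalled set" where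
  "recalleds t = {w. length w = t}"

definition recall :: "('a, 'x) process \<Rightarrow> ('a, 'x) hist \<Rightarrow> ('a, 'x) recalled" where
  "recall Z h = map (\<lambda>k. (fst (h ! k), Z k (take k h), snd (h ! k))) [0..<length h]"

definition state :: "('s, 'a, 'x) mdp \<Rightarrow> ('a, 'x) recalled \<Rightarrow> 's" where
  "state M w =
     fold (\<lambda>k s. dyn M k s (fst (w ! k)) (snd (snd (w ! k)))) [0..<length w] (init M)"

type_synonym ('a, 'x) policy = "nat \<Rightarrow> ('a, 'x) hist \<Rightarrow> 'a \<times> real"

primrec hist_law ::
    "('s, 'a, 'x) mdp \<Rightarrow> ('a, 'x) policy \<Rightarrow> nat \<Rightarrow> ('a, 'x) hist pmf" where
  "hist_law M \<pi> 0 = return_pmf []"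
| "hist_law M \<pi> (Suc t) =
     bind_pmf (hist_law M \<pi> t) (\<lambda>h. map_pmf (\<lambda>\<xi>. h @ [(fst (\<pi> t h), \<xi>)]) (law M t))"

definition is_min :: "'b::order \<Rightarrow> 'b set \<Rightarrow> bool" where
  "is_min v S \<longleftrightarrow> v \<in> S \<and> (\<forall>w\<in>S. v \<le> w)"

text \<open>
  Conditioning an element of period \<open>t + 1\<close> on a history \<open>h\<close> of period \<open>t\<close> needs the action taken
  at \<open>h\<close>. It is given by an action rule \<open>\<alpha>\<close>, the action component of the policy in force; a risk
  frontier is accordingly a set of triples for each action rule. Such an element is compared almost
  surely under the law of the datum of period \<open>t\<close>, conditionally on every \<open>h\<close>. Disbursements and
  premiums are compared at every history, null or not, since the recursive description constrains
  them at every history.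
\<close>

definition risk_frontier ::
    "('s, 'a, 'x) mdp \<Rightarrow> (nat \<Rightarrow> ('a, 'x) hist \<Rightarrow> 'a) \<Rightarrow> ('a, 'x) triple set \<Rightarrow> bool" where
  "risk_frontier M \<alpha> U \<longleftrightarrow>
     (\<forall>X X' Z \<Phi>. (X, Z, \<Phi>) \<in> U \<and>
        (\<forall>t\<le>horizon M. \<forall>h\<in>hists t. AE \<xi> in law M t.
           X t (h @ [(\<alpha> t h, \<xi>)]) \<le> X' t (h @ [(\<alpha> t h, \<xi>)])) \<longrightarrow>
        (X', Z, \<Phi>) \<in> U) \<and>
     (\<forall>X Z \<Phi> \<Phi>'. (X, Z, \<Phi>) \<in> U \<and>
        (\<forall>t\<le>horizon M. \<forall>h\<in>hists t. 0 \<le> \<Phi>' t h) \<and>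
        (\<forall>t<horizon M. \<forall>h\<in>hists t.
           measure_pmf.expectation (law M t) (\<lambda>\<xi>. \<Phi>' (Suc t) (h @ [(\<alpha> t h, \<xi>)])) \<le> \<Phi>' t h) \<longrightarrow>
        (X, Z, \<lambda>t h. \<Phi> t h + \<Phi>' t h) \<in> U) \<and>
     (\<forall>X Z Z' \<Phi>. (X, Z, \<Phi>) \<in> U \<and>
        (\<forall>t\<le>horizon M. \<forall>h\<in>hists t. Z t h \<le> Z' t h) \<longrightarrow>
        (\<exists>\<Phi>'. (\<forall>t\<le>horizon M. \<forall>h\<in>hists t. \<Phi> t h \<le> \<Phi>' t h) \<and> (X, Z', \<Phi>') \<in> U)) \<and>
     closed U"

text \<open>
  \<open>C t w \<Psi>\<close> is the value of the correspondence of period \<open>t\<close> at the history \<open>w\<close>, where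
  payoff and next premium \<open>\<Psi>\<close>, conditionally on \<open>w\<close> and the decisions of period \<open>t\<close>, are random
  variables of the datum of period \<open>t\<close>.
\<close>

type_synonym ('a, 'x) correspondence =
  "nat \<Rightarrow> ('a, 'x) recalled \<Rightarrow> ('x \<Rightarrow> real) \<Rightarrow> (('x \<Rightarrow> real) \<times> real \<times> real) set"

text \<open>The terminal input is a function of the final history, past disbursements included.\<close>

definition next_premium ::
    "('s, 'a, 'x) mdp \<Rightarrow> (('a, 'x) recalled \<Rightarrow> real) \<Rightarrow> ('a, 'x) process \<Rightarrow> ('a, 'x) process
      \<Rightarrow> nat \<Rightarrow> ('a, 'x) hist \<Rightarrow> real" where
  "next_premium M \<Phi>term Z \<Phi> t h = (if t = horizon M then \<Phi>term (recall Z h) else \<Phi> (Suc t) h)"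

definition recursive_frontier ::
    "('s, 'a, 'x) mdp \<Rightarrow> ('a, 'x) correspondence \<Rightarrow> (('a, 'x) recalled \<Rightarrow> real)
      \<Rightarrow> (nat \<Rightarrow> ('a, 'x) hist \<Rightarrow> 'a) \<Rightarrow> ('a, 'x) triple set" where
  "recursive_frontier M C \<Phi>term \<alpha> =
     {(X, Z, \<Phi>). \<forall>t\<le>horizon M. \<forall>h\<in>hists t.
        (\<lambda>\<xi>. X t (h @ [(\<alpha> t h, \<xi>)]), Z t h, \<Phi> t h)
          \<in> C t (recall Z h) (\<lambda>\<xi>. next_premium M \<Phi>term Z \<Phi> t (h @ [(\<alpha> t h, \<xi>)]))}"

definition recursive_structure ::
    "('s, 'a, 'x) mdp \<Rightarrow> ('a, 'x) correspondence \<Rightarrow> (('a, 'x) recalled \<Rightarrow> real)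
      \<Rightarrow> ((nat \<Rightarrow> ('a, 'x) hist \<Rightarrow> 'a) \<Rightarrow> ('a, 'x) triple set) \<Rightarrow> bool" where
  "recursive_structure M C \<Phi>term U \<longleftrightarrow>
     (\<forall>\<alpha>. U \<alpha> = recursive_frontier M C \<Phi>term \<alpha>) \<and>
     (\<forall>t\<le>horizon M. \<forall>w\<in>recalleds t. \<forall>\<Psi> X X' z \<phi>.
        (X, z, \<phi>) \<in> C t w \<Psi> \<and> (AE \<xi> in law M t. X \<xi> \<le> X' \<xi>) \<longrightarrow> (X', z, \<phi>) \<in> C t w \<Psi>) \<and>
     (\<forall>t\<le>horizon M. \<forall>w\<in>recalleds t. \<forall>\<Psi> \<Psi>'.
        (AE \<xi> in law M t. \<Psi> \<xi> \<le> \<Psi>' \<xi>) \<longrightarrow> C t w \<Psi>' \<subseteq> C t w \<Psi>)"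

text \<open>
  The Banach spaces of the different periods are closed subspaces of one Banach space, which is
  no restriction for finitely many of them. \<open>state_of t\<close> reads off the state component of an
  information state, and \<open>terminal\<close> is the terminal input as a function of the information state.
\<close>

record ('s, 'a, 'x, 'y) info =
  ispace :: "nat \<Rightarrow> 'y set"
  compress :: "nat \<Rightarrow> ('a, 'x) recalled \<Rightarrow> 'y"
  evolve :: "nat \<Rightarrow> 'y \<Rightarrow> 'a \<Rightarrow> real \<Rightarrow> 'x \<Rightarrow> 'y"
  state_of :: "nat \<Rightarrow> 'y \<Rightarrow> 's"
  terminal :: "'y \<Rightarrow> real"

definition attained :: "('s, 'a, 'x, 'y) info \<Rightarrow> nat \<Rightarrow> 'y set" where
  "attained I t = compress I t ` recalleds t"

text \<open>
  In the Markov condition the actions and disbursements before period \<open>t\<close> come from an arbitrary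
  policy, those of period \<open>t\<close> are the given \<open>a\<close>, \<open>z\<close>, and the datum of period \<open>t\<close> is independent
  of the history; the condition is required at histories of positive probability.
\<close>

definition markov_information ::
    "('s, 'a, 'x) mdp \<Rightarrow> ('s, 'a, 'x, 'y) info \<Rightarrow> bool" where
  "markov_information M I \<longleftrightarrow>
     (\<forall>\<pi> t a z B. t \<le> horizon M \<longrightarrow>
        (let w = recall (\<lambda>k h. snd (\<pi> k h)) in
         \<forall>h\<in>set_pmf (hist_law M \<pi> t).
           \<P>(\<xi> in law M t. compress I (Suc t) (w h @ [(a, z, \<xi>)]) \<in> B) =
           \<P>(p in pair_pmf (hist_law M \<pi> t) (law M t).
               compress I (Suc t) (w (fst p) @ [(a, z, snd p)]) \<in> B
             \<bar> compress I t (w (fst p)) = compress I t (w h))))"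

definition correspondence_at ::
    "('a, 'x) correspondence \<Rightarrow> nat \<Rightarrow> ('a, 'x) recalled \<Rightarrow> 'a \<Rightarrow> (('a, 'x) recalled \<Rightarrow> real)
      \<Rightarrow> (('x \<Rightarrow> real) \<times> real \<times> real) set" where
  "correspondence_at C t w a \<Psi> = {(X, z, \<phi>). (X, z, \<phi>) \<in> C t w (\<lambda>\<xi>. \<Psi> (w @ [(a, z, \<xi>)]))}"

definition information_state_generator ::
    "('s, 'a, 'x) mdp \<Rightarrow> ('a, 'x) correspondence \<Rightarrow> (('a, 'x) recalled \<Rightarrow> real)
      \<Rightarrow> ('s, 'a, 'x, 'y::banach) info \<Rightarrow> bool" where
  "information_state_generator M C \<Phi>term I \<longleftrightarrow>
     (\<forall>t\<le>Suc (horizon M). subspace (ispace I t) \<and> closed (ispace I t) \<and>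
        compress I t ` recalleds t \<subseteq> ispace I t) \<and>
     (\<forall>t\<le>horizon M. \<forall>w\<in>recalleds t. state_of I t (compress I t w) = state M w) \<and>
     (\<forall>t\<le>horizon M. \<forall>y\<in>ispace I t. \<forall>a z \<xi>. evolve I t y a z \<xi> \<in> ispace I (Suc t)) \<and>
     (\<forall>t\<le>horizon M. \<forall>w\<in>recalleds t. \<forall>a z \<xi>.
        compress I (Suc t) (w @ [(a, z, \<xi>)]) = evolve I t (compress I t w) a z \<xi>) \<and>
     markov_information M I \<and>
     (\<forall>w\<in>recalleds (Suc (horizon M)).
        \<Phi>term w = terminal I (compress I (Suc (horizon M)) w)) \<and>
     (\<forall>t\<le>horizon M. \<forall>w\<in>recalleds t. \<forall>w'\<in>recalleds t. \<forall>(\<Phi> :: 'y \<Rightarrow> real) a.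
        compress I t w = compress I t w' \<longrightarrow>
        correspondence_at C t w a (\<lambda>v. \<Phi> (compress I (Suc t) v)) =
        correspondence_at C t w' a (\<lambda>v. \<Phi> (compress I (Suc t) v)))"

text \<open>
  Markov premiums and disbursements of period \<open>t\<close> are functions of the information state of
  period \<open>t\<close>; Markov payoffs of period \<open>t\<close> are functions of the information state, the action and
  the datum of period \<open>t\<close>. Along the finitely many histories under a policy they are bounded random
  variables. Only their values at attained information states matter.
\<close>

type_synonym 'y ipremium = "nat \<Rightarrow> 'y \<Rightarrow> real"
type_synonym ('a, 'x, 'y) ipayoff = "nat \<Rightarrow> 'y \<Rightarrow> 'a \<Rightarrow> 'x \<Rightarrow> real"
type_synonym ('a, 'y) ipolicy = "nat \<Rightarrow> 'y \<Rightarrow> 'a \<times> real"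

definition ipolicy_payoff ::
    "('s, 'a, 'x) mdp \<Rightarrow> ('s, 'a, 'x, 'y) info \<Rightarrow> ('a, 'y) ipolicy \<Rightarrow> ('a, 'x, 'y) ipayoff" where
  "ipolicy_payoff M I \<pi> t y a \<xi> = payoff M t (state_of I t y) (fst (\<pi> t y)) \<xi>"

definition ipolicy_disb :: "('a, 'y) ipolicy \<Rightarrow> 'y ipremium" where
  "ipolicy_disb \<pi> t y = snd (\<pi> t y)"

definition ipolicy_act :: "('a, 'y) ipolicy \<Rightarrow> nat \<Rightarrow> 'y \<Rightarrow> 'a" where
  "ipolicy_act \<pi> t y = fst (\<pi> t y)"

text \<open>The choice of the history is immaterial for an information state generator.\<close>

definition Ubar_at ::
    "('a, 'x) correspondence \<Rightarrow> ('s, 'a, 'x, 'y) info \<Rightarrow> nat \<Rightarrow> 'y \<Rightarrow> 'a \<Rightarrow> ('y \<Rightarrow> real)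
      \<Rightarrow> (('x \<Rightarrow> real) \<times> real \<times> real) set" where
  "Ubar_at C I t y a \<Phi> =
     {(X, z, \<phi>). (X, z, \<phi>) \<in> C t (SOME w. w \<in> recalleds t \<and> compress I t w = y)
        (\<lambda>\<xi>. \<Phi> (evolve I t y a z \<xi>))}"

definition next_ipremium ::
    "('s, 'a, 'x) mdp \<Rightarrow> ('s, 'a, 'x, 'y) info \<Rightarrow> 'y ipremium \<Rightarrow> nat \<Rightarrow> 'y \<Rightarrow> real" where
  "next_ipremium M I \<Phi> t = (if t = horizon M then terminal I else \<Phi> (Suc t))"

definition Ubar ::
    "('s, 'a, 'x) mdp \<Rightarrow> ('a, 'x) correspondence \<Rightarrow> ('s, 'a, 'x, 'y) info \<Rightarrow> (nat \<Rightarrow> 'y \<Rightarrow> 'a)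
      \<Rightarrow> (('a, 'x, 'y) ipayoff \<times> 'y ipremium \<times> 'y ipremium) set" where
  "Ubar M C I \<alpha> =
     {(X, Z, \<Phi>). \<forall>t\<le>horizon M. \<forall>y\<in>attained I t.
        (X t y (\<alpha> t y), Z t y, \<Phi> t y) \<in> Ubar_at C I t y (\<alpha> t y) (next_ipremium M I \<Phi> t)}"

definition tail_feasible ::
    "('s, 'a, 'x) mdp \<Rightarrow> ('a, 'x) correspondence \<Rightarrow> ('s, 'a, 'x, 'y) info \<Rightarrow> ('a, 'y) ipolicy
      \<Rightarrow> nat \<Rightarrow> 'y ipremium \<Rightarrow> bool" where
  "tail_feasible M C I \<pi> t \<Phi> \<longleftrightarrow>
     (\<forall>k\<in>{t..horizon M}. \<forall>y\<in>attained I k.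
        (ipolicy_payoff M I \<pi> k y (ipolicy_act \<pi> k y), ipolicy_disb \<pi> k y, \<Phi> k y)
          \<in> Ubar_at C I k y (ipolicy_act \<pi> k y) (next_ipremium M I \<Phi> k))"

text \<open>The infimum over an infeasible problem is \<open>\<infinity>\<close>.\<close>

definition Vbar_policy ::
    "('s, 'a, 'x) mdp \<Rightarrow> ('a, 'x) correspondence \<Rightarrow> ('s, 'a, 'x, 'y) info \<Rightarrow> ('a, 'y) ipolicy
      \<Rightarrow> nat \<Rightarrow> 'y \<Rightarrow> ereal" where
  "Vbar_policy M C I \<pi> t y = (INF \<Phi> \<in> {\<Phi>. tail_feasible M C I \<pi> t \<Phi>}. ereal (\<Phi> t y))"

definition Vbar ::
    "('s, 'a, 'x) mdp \<Rightarrow> ('a, 'x) correspondence \<Rightarrow> ('s, 'a, 'x, 'y) info \<Rightarrow> nat \<Rightarrow> 'y \<Rightarrow> ereal" where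
  "Vbar M C I t y =
     (if t = Suc (horizon M) then ereal (terminal I y) else (INF \<pi>. Vbar_policy M C I \<pi> t y))"

text \<open>
  The dominance constraints carry the action witnessing them, since the membership in
  \<open>Ubar_at\<close> that goes with them is conditional on the same action.
\<close>

definition Dbar ::
    "('s, 'a, 'x) mdp \<Rightarrow> ('s, 'a, 'x, 'y) info \<Rightarrow> nat \<Rightarrow> 'y \<Rightarrow> 'a \<Rightarrow> ('y \<Rightarrow> ereal)
      \<Rightarrow> (('y \<Rightarrow> 'a \<Rightarrow> 'x \<Rightarrow> real) \<times> real \<times> ('y \<Rightarrow> real)) set" where
  "Dbar M I t y a V =
     {(X, z, \<Phi>). \<forall>\<xi>. X y a \<xi> \<le> payoff M t (state_of I t y) a \<xi> \<and>
        V (evolve I t y a z \<xi>) \<le> ereal (\<Phi> (evolve I t y a z \<xi>))}"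

definition Qbar ::
    "('s, 'a, 'x) mdp \<Rightarrow> ('a, 'x) correspondence \<Rightarrow> ('s, 'a, 'x, 'y) info \<Rightarrow> nat \<Rightarrow> 'y
      \<Rightarrow> ('y \<Rightarrow> ereal) \<Rightarrow> (('y \<Rightarrow> 'a \<Rightarrow> 'x \<Rightarrow> real) \<times> real \<times> real) set" where
  "Qbar M C I t y V =
     {(X, z, \<phi>). \<exists>\<Phi> a. (X y a, z, \<phi>) \<in> Ubar_at C I t y a \<Phi> \<and> (X, z, \<Phi>) \<in> Dbar M I t y a V}"

end

(*
  The lower bound holds because one policy is optimal at all information states at once. At each
  (k, y) take the decision that an optimal policy for (k, y) makes there; its premium of period
  k + 1 dominates the value function, so by antitonicity of the correspondence the decision remains
  feasible with the value function as premium process. Changing this policy at the single state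
  (t, y) to a given element of Qbar yields a competitor in the definition of Vbar.
*)
theory Submission
  imports Defs
begin

text \<open>Appending a decision and a datum to a history that attains \<open>y\<close> gives a
  history of the next period. Comparisons of value functions can thus stay within attained states,
  where \<open>Vbar\<close> is known to be finite.\<close>

lemma evolve_attained:
  assumes "information_state_generator M C \<Phi>term I" "t \<le> horizon M" "y \<in> attained I t"
  shows "evolve I t y a z \<xi> \<in> attained I (Suc t)"
proof -
  from assms(3) obtain w where w: "w \<in> recalleds t" "y = compress I t w"
    by (auto simp: attained_def)
  then have "compress I (Suc t) (w @ [(a, z, \<xi>)]) = evolve I t y a z \<xi>"
    using assms(1,2) unfolding information_state_generator_def by blast
  moreover have "w @ [(a, z, \<xi>)] \<in> recalleds (Suc t)"
    using w(1) by (simp add: recalleds_def)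
  ultimately show ?thesis
    unfolding attained_def by (metis imageI)
qed

text \<open>Conditions (b) and (c) of the recursive structure, carried over to the information
  state. The decision \<open>(a, z)\<close> is held fixed, as it determines the successor states at
  which the premiums are compared.\<close>

lemma Ubar_at_mono:
  assumes rec: "recursive_structure M C \<Phi>term U" and t: "t \<le> horizon M" and y: "y \<in> attained I t"
    and mem: "(X, z, \<phi>) \<in> Ubar_at C I t y a \<Phi>"
    and X: "\<And>\<xi>. X \<xi> \<le> X' \<xi>"
    and \<Phi>: "\<And>\<xi>. \<Phi>' (evolve I t y a z \<xi>) \<le> \<Phi> (evolve I t y a z \<xi>)"
  shows "(X', z, \<phi>) \<in> Ubar_at C I t y a \<Phi>'"
proof -
  \<comment> \<open>This is the representative history chosen inside \<open>Ubar_at\<close>; it is a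
    genuine one because \<open>y\<close> is attained.\<close>
  define w where "w = (SOME w. w \<in> recalleds t \<and> compress I t w = y)"
  have w: "w \<in> recalleds t"
    using y someI_ex[of "\<lambda>w. w \<in> recalleds t \<and> compress I t w = y"]
    unfolding w_def attained_def by blast
  have "(X, z, \<phi>) \<in> C t w (\<lambda>\<xi>. \<Phi> (evolve I t y a z \<xi>))"
    using mem by (simp add: Ubar_at_def w_def)
  moreover have "C t w (\<lambda>\<xi>. \<Phi> (evolve I t y a z \<xi>)) \<subseteq> C t w (\<lambda>\<xi>. \<Phi>' (evolve I t y a z \<xi>))"
    using rec t w \<Phi> unfolding recursive_structure_def by (simp add: AE_measure_pmf_iff)
  ultimately have "(X, z, \<phi>) \<in> C t w (\<lambda>\<xi>. \<Phi>' (evolve I t y a z \<xi>))"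
    by blast
  moreover have "AE \<xi> in law M t. X \<xi> \<le> X' \<xi>"
    using X by simp
  ultimately have "(X', z, \<phi>) \<in> C t w (\<lambda>\<xi>. \<Phi>' (evolve I t y a z \<xi>))"
    using rec t w unfolding recursive_structure_def by blast
  then show ?thesis
    by (simp add: Ubar_at_def w_def)
qed

lemma Vbar_le:
  assumes "t \<le> horizon M" "tail_feasible M C I \<pi> t \<Phi>"
  shows "Vbar M C I t y \<le> ereal (\<Phi> t y)"
proof -
  have "Vbar M C I t y \<le> Vbar_policy M C I \<pi> t y"
    using assms(1) by (auto simp: Vbar_def intro: INF_lower)
  also have "\<dots> \<le> ereal (\<Phi> t y)"
    unfolding Vbar_policy_def using assms(2) by (intro INF_lower) simp
  finally show ?thesis .
qed

text \<open>At the horizon both sides are the terminal input. Earlier, dropping the constraints of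
  period \<open>t\<close> leaves \<Phi> a competitor in the value function of period
  \<open>t + 1\<close>.\<close>

lemma Vbar_le_next_ipremium:
  assumes "t \<le> horizon M" "tail_feasible M C I \<pi> t \<Phi>"
  shows "Vbar M C I (Suc t) y \<le> ereal (next_ipremium M I \<Phi> t y)"
proof (cases "t = horizon M")
  case True
  then show ?thesis by (simp add: Vbar_def next_ipremium_def)
next
  case False
  have "tail_feasible M C I \<pi> (Suc t) \<Phi>"
    using assms(2) by (auto simp: tail_feasible_def)
  with False assms(1) show ?thesis
    by (simp add: next_ipremium_def Vbar_le)
qed

lemma tail_feasibleD:
  assumes "tail_feasible M C I \<pi> t \<Phi>" "t \<le> horizon M" "y \<in> attained I t"
  shows "(payoff M t (state_of I t y) (fst (\<pi> t y)), snd (\<pi> t y), \<Phi> t y)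
           \<in> Ubar_at C I t y (fst (\<pi> t y)) (next_ipremium M I \<Phi> t)"
  using assms by (simp add: tail_feasible_def ipolicy_payoff_def[abs_def] ipolicy_disb_def
      ipolicy_act_def)

lemma Ubar_iff_tail_feasible:
  "(ipolicy_payoff M I \<pi>, ipolicy_disb \<pi>, \<Phi>) \<in> Ubar M C I (ipolicy_act \<pi>) \<longleftrightarrow>
     tail_feasible M C I \<pi> 0 \<Phi>"
  by (auto simp: Ubar_def tail_feasible_def)

text \<open>Applied to a minimizing pair of policy and premiums, this shows that the minimum over
  \<open>Qbar\<close> is attained.\<close>

lemma tail_feasible_imp_Qbar:
  assumes t: "t \<le> horizon M" and y: "y \<in> attained I t"
    and feas: "tail_feasible M C I \<pi> t \<Phi>"
  shows "(ipolicy_payoff M I \<pi> t, snd (\<pi> t y), \<Phi> t y) \<in> Qbar M C I t y (Vbar M C I (Suc t))"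
  \<comment> \<open>The witnesses are \<open>next_ipremium M I \<Phi> t\<close> and the policy's own
    action, for which the payoff constraint of \<open>Dbar\<close> is an equality.\<close>
  using tail_feasibleD[OF feas t y] Vbar_le_next_ipremium[OF t feas]
  unfolding Qbar_def Dbar_def ipolicy_payoff_def[abs_def] by auto

lemma Vbar_le_Qbar:
  assumes rec: "recursive_structure M C \<Phi>term U"
    and gen: "information_state_generator M C \<Phi>term I"
    and minima: "\<And>t y. t \<le> horizon M \<Longrightarrow> y \<in> attained I t \<Longrightarrow>
      \<exists>\<pi> \<Phi>. tail_feasible M C I \<pi> t \<Phi> \<and> ereal (\<Phi> t y) = Vbar M C I t y"
    and t: "t \<le> horizon M" and y: "y \<in> attained I t"
    and Q: "(X, z, \<phi>) \<in> Qbar M C I t y (Vbar M C I (Suc t))"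
  shows "Vbar M C I t y \<le> ereal \<phi>"
proof -
  \<comment> \<open>Premiums are real while \<open>Vbar\<close> is extended real, so
    \<open>v\<close> is its real version, faithful at attained states by
    \<open>minima\<close>.\<close>
  define v where "v = (\<lambda>k y. real_of_ereal (Vbar M C I k y))"
  have v: "ereal (v k y') = Vbar M C I k y'" if "k \<le> horizon M" "y' \<in> attained I k" for k y'
    using minima[OF that] unfolding v_def by (metis real_of_ereal.simps(1))
  have v_next: "ereal (next_ipremium M I v k y') = Vbar M C I (Suc k) y'"
    if "k \<le> horizon M" "y' \<in> attained I (Suc k)" for k y'
    using that v[of "Suc k" y'] by (auto simp: next_ipremium_def Vbar_def)
  have "\<exists>p. (payoff M k (state_of I k y') (fst p), snd p, v k y')
              \<in> Ubar_at C I k y' (fst p) (next_ipremium M I v k)"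
    if k: "k \<le> horizon M" "y' \<in> attained I k" for k y'
  proof -
    obtain \<pi> \<Phi> where feas: "tail_feasible M C I \<pi> k \<Phi>" and "ereal (\<Phi> k y') = Vbar M C I k y'"
      using minima[OF k] by blast
    then have eq: "\<Phi> k y' = v k y'"
      by (metis v[OF k] ereal.inject)
    have "next_ipremium M I v k y'' \<le> next_ipremium M I \<Phi> k y''" if "y'' \<in> attained I (Suc k)" for y''
      using Vbar_le_next_ipremium[OF k(1) feas, of y''] v_next[OF k(1) that]
      by (metis ereal_less_eq(3))
    then show ?thesis
      using Ubar_at_mono[OF rec k tail_feasibleD[OF feas k] order_refl] evolve_attained[OF gen k]
      unfolding eq by blast
  qed
  \<comment> \<open>Choice over all \<open>k\<close> and \<open>y'\<close> glues the separate
    optimal decisions into one policy \<open>p\<close>, with \<open>v\<close> as its premium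
    process.\<close>
  then obtain p where p: "\<And>k y'. k \<le> horizon M \<Longrightarrow> y' \<in> attained I k \<Longrightarrow>
      (payoff M k (state_of I k y') (fst (p k y')), snd (p k y'), v k y')
        \<in> Ubar_at C I k y' (fst (p k y')) (next_ipremium M I v k)"
    by metis
  obtain a \<Phi> where mem: "(X y a, z, \<phi>) \<in> Ubar_at C I t y a \<Phi>"
    and X: "\<And>\<xi>. X y a \<xi> \<le> payoff M t (state_of I t y) a \<xi>"
    and dom: "\<And>\<xi>. Vbar M C I (Suc t) (evolve I t y a z \<xi>) \<le> ereal (\<Phi> (evolve I t y a z \<xi>))"
    using Q by (auto simp: Qbar_def Dbar_def)
  \<comment> \<open>The two inequalities of \<open>Dbar\<close> allow \<open>X\<close> to be raised
    to the payoff earned under \<open>a\<close> and \<Phi> to be lowered to the value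
    function.\<close>
  have step: "(payoff M t (state_of I t y) a, z, \<phi>) \<in> Ubar_at C I t y a (next_ipremium M I v t)"
  proof (rule Ubar_at_mono[OF rec t y mem X])
    show "next_ipremium M I v t (evolve I t y a z \<xi>) \<le> \<Phi> (evolve I t y a z \<xi>)" for \<xi>
      using dom[of \<xi>] by (simp flip: v_next[OF t evolve_attained[OF gen t y]])
  qed
  define \<pi>' where "\<pi>' = p(t := (p t)(y := (a, z)))"
  define \<Phi>' where "\<Phi>' = v(t := (v t)(y := \<phi>))"
  \<comment> \<open>From period \<open>t\<close> on, only premiums of periods after \<open>t\<close>
    enter as next premiums, so the change at \<open>(t, y)\<close> disturbs no other
    constraint.\<close>
  have next': "next_ipremium M I \<Phi>' k = next_ipremium M I v k" if "t \<le> k" for k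
    using that by (simp add: next_ipremium_def \<Phi>'_def)
  have "tail_feasible M C I \<pi>' t \<Phi>'"
    unfolding tail_feasible_def ipolicy_payoff_def[abs_def] ipolicy_disb_def ipolicy_act_def
  proof (intro ballI)
    fix k y' assume "k \<in> {t..horizon M}" and y': "y' \<in> attained I k"
    then have k: "t \<le> k" "k \<le> horizon M" by auto
    show "(payoff M k (state_of I k y') (fst (\<pi>' k y')), snd (\<pi>' k y'), \<Phi>' k y')
            \<in> Ubar_at C I k y' (fst (\<pi>' k y')) (next_ipremium M I \<Phi>' k)"
    proof (cases "k = t \<and> y' = y")
      case True
      then have "\<pi>' k y' = (a, z)" "\<Phi>' k y' = \<phi>"
        by (auto simp: \<pi>'_def \<Phi>'_def)
      then show ?thesis using step True by (simp add: next')
    next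
      case False
      then have "\<pi>' k y' = p k y'" "\<Phi>' k y' = v k y'"
        by (auto simp: \<pi>'_def \<Phi>'_def)
      then show ?thesis using p[OF k(2) y'] by (simp add: next'[OF k(1)])
    qed
  qed
  from Vbar_le[OF t this, of y] show ?thesis
    by (simp add: \<Phi>'_def)
qed

theorem theorem28:
  fixes M :: "('s::finite, 'a::finite, 'x::finite) mdp"
    and C :: "('a, 'x) correspondence"
    and \<Phi>term :: "('a, 'x) recalled \<Rightarrow> real"
    and U :: "(nat \<Rightarrow> ('a, 'x) hist \<Rightarrow> 'a) \<Rightarrow> ('a, 'x) triple set"
    and I :: "('s, 'a, 'x, 'y::banach) info"
    and Rmax :: real
  assumes bounded_payoffs: "\<And>t s a \<xi>. t \<le> horizon M \<Longrightarrow> \<bar>payoff M t s a \<xi>\<bar> \<le> Rmax"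
    and frontier: "\<And>\<alpha>. risk_frontier M \<alpha> (U \<alpha>)"
    and recursive: "recursive_structure M C \<Phi>term U"
    and generator: "information_state_generator M C \<Phi>term I"
    and minima: "\<And>t y. t \<le> horizon M \<Longrightarrow> y \<in> attained I t \<Longrightarrow>
      \<exists>\<pi> \<Phi>. tail_feasible M C I \<pi> t \<Phi> \<and> ereal (\<Phi> t y) = Vbar M C I t y"
    and bounded_values: "\<And>t. t \<le> horizon M \<Longrightarrow>
      \<exists>B::real. \<forall>y\<in>attained I t. \<bar>Vbar M C I t y\<bar> \<le> ereal B"
  shows "(\<forall>t\<le>horizon M. \<forall>y\<in>attained I t.
            is_min (Vbar M C I t y)
              {ereal \<phi> | X z \<phi>. (X, z, \<phi>) \<in> Qbar M C I t y (Vbar M C I (Suc t))}) \<and>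
         is_min (Vbar M C I 0 (compress I 0 []))
           {ereal (\<Phi> 0 (compress I 0 [])) | \<pi> \<Phi>.
             (ipolicy_payoff M I \<pi>, ipolicy_disb \<pi>, \<Phi>) \<in> Ubar M C I (ipolicy_act \<pi>)}"
proof (intro conjI allI impI ballI)
  fix t y assume t: "t \<le> horizon M" and y: "y \<in> attained I t"
  obtain \<pi> \<Phi> where "tail_feasible M C I \<pi> t \<Phi>" "ereal (\<Phi> t y) = Vbar M C I t y"
    using minima[OF t y] by blast
  then show "is_min (Vbar M C I t y)
      {ereal \<phi> | X z \<phi>. (X, z, \<phi>) \<in> Qbar M C I t y (Vbar M C I (Suc t))}"
    \<comment> \<open>The first fact puts the value into the set; the second makes it a lower
      bound.\<close>
    using tail_feasible_imp_Qbar[OF t y, of C \<pi> \<Phi>] Vbar_le_Qbar[OF recursive generator minima t y]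
    unfolding is_min_def by (smt (verit, best) mem_Collect_eq)
next
  have "compress I 0 [] \<in> attained I 0"
    by (simp add: attained_def recalleds_def)
  then obtain \<pi> \<Phi> where "tail_feasible M C I \<pi> 0 \<Phi>"
      "ereal (\<Phi> 0 (compress I 0 [])) = Vbar M C I 0 (compress I 0 [])"
    using minima by blast
  then show "is_min (Vbar M C I 0 (compress I 0 []))
      {ereal (\<Phi> 0 (compress I 0 [])) | \<pi> \<Phi>.
        (ipolicy_payoff M I \<pi>, ipolicy_disb \<pi>, \<Phi>) \<in> Ubar M C I (ipolicy_act \<pi>)}"
    \<comment> \<open>The problem on the information state is the tail problem from period 0, so
      \<open>Vbar_le\<close> bounds every competitor and the pair obtained above attains the
      bound.\<close>
    unfolding is_min_def Ubar_iff_tail_feasible mem_Collect_eq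
    by (auto simp: Vbar_le) metis
qed

end
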